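(* Let $M=\{0,z\}\cup\{x_i:i\in\mathbb N\}$ be the countable metric graph (all listed points distinct) whose edges are exactly the pairs $\{0,x_i\}$ and $\{x_i,z\}$, $i\in\mathbb N$, and let $d$ be the shortest path distance on $M$. For every $1<p<\infty$, the space $(M,d)$ embeds into $\ell_p$ with distortion $D<2$. Consequently, $\ell_p$ contains a subset $A$ failing the LTP.
   Context: Thus $d(0,x_i)=d(x_i,z)=1$, $d(0,z)=2$, and $d(x_i,x_j)=2$ for $i\neq j$. "$(M,d)$ embeds into $\ell_p$ with distortion $D$" means that there are a map $\phi:M\to\ell_p$ and $s>0$ such that $\frac{s}{D}d(x,y)\leq\|\phi(x)-\phi(y)\|_p\leq s\,d(x,y)$ for all $x,y\in M$. A metric space $(M,d)$ has the long trapezoid property (LTP) if for each finite subset $N\subseteq M$ and each $\varepsilon>0$ there exist $u,v\in M$, $u\neq v$, such that $(1-\varepsilon)(d(x,y)+d(u,v))\leq d(x,u)+d(y,v)$ holds for all $x,y\in N$; it fails the LTP if it does not have it. Subsets of $\ell_p$ carry the metric induced by the norm $\|\cdot\|_p$. *)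

theory Defs
  imports "HOL-Analysis.Analysis"
begin

section \<open>Shortest path distance\<close>

text \<open>
  A simple graph is given by its set of edges, each an unordered pair. The \<open>n\<close>-fold relational
  power of the adjacency relation relates the end points of walks with \<open>n\<close> edges. The distance is
  meaningful only for vertices joined by a walk.
\<close>

definition graph_dist :: "'a set set \<Rightarrow> 'a \<Rightarrow> 'a \<Rightarrow> real" where
  "graph_dist E x y = real (LEAST n. (x, y) \<in> {(a, b). {a, b} \<in> E} ^^ n)"

text \<open>The points \<open>0\<close>, \<open>z\<close> and \<open>x\<^sub>i\<close> are \<open>Origin\<close>, \<open>Apex\<close> and \<open>Mid i\<close>.\<close>

datatype point = Origin | Apex | Mid nat

definition M_edges :: "point set set" where
  "M_edges = (\<Union>i. {{Origin, Mid i}, {Mid i, Apex}})"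

definition M_dist :: "point \<Rightarrow> point \<Rightarrow> real" where
  "M_dist = graph_dist M_edges"

lemma M_adjacency:
  "{(a, b). {a, b} \<in> M_edges} =
     (\<Union>i. {(Origin, Mid i), (Mid i, Origin), (Apex, Mid i), (Mid i, Apex)})"
  unfolding M_edges_def by (auto simp: doubleton_eq_iff)

lemma graph_dist_eqI:
  assumes "(x, y) \<in> {(a, b). {a, b} \<in> E} ^^ n"
    and "\<And>m. m < n \<Longrightarrow> (x, y) \<notin> {(a, b). {a, b} \<in> E} ^^ m"
  shows "graph_dist E x y = real n"
  unfolding graph_dist_def using assms by (metis Least_equality not_le)

lemma M_dist_simps:
  "M_dist x x = 0"
  "M_dist Origin (Mid i) = 1" "M_dist (Mid i) Origin = 1"
  "M_dist (Mid i) Apex = 1" "M_dist Apex (Mid i) = 1"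
  "M_dist Origin Apex = 2" "M_dist Apex Origin = 2"
  "i \<noteq> j \<Longrightarrow> M_dist (Mid i) (Mid j) = 2"
proof -
  let ?R = "{(a, b). {a, b} \<in> M_edges}"
  have 0: "M_dist x x = 0" for x
    unfolding M_dist_def using graph_dist_eqI[where x = x and y = x and E = M_edges and n = 0] by simp
  have 1: "M_dist x y = 1" if "(x, y) \<in> ?R" "x \<noteq> y" for x y
    unfolding M_dist_def using graph_dist_eqI[where x = x and y = y and E = M_edges and n = 1] that by simp
  have 2: "M_dist x y = 2" if "(x, w) \<in> ?R" "(w, y) \<in> ?R" "(x, y) \<notin> ?R" "x \<noteq> y" for x y w
  proof -
    have "(x, y) \<in> ?R ^^ 2"
      using that(1,2) by (auto simp: numeral_2_eq_2)
    moreover have "(x, y) \<notin> ?R ^^ m" if "m < 2" for m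
      using that \<open>(x, y) \<notin> ?R\<close> \<open>x \<noteq> y\<close> by (auto simp: less_2_cases_iff)
    ultimately show ?thesis
      unfolding M_dist_def using graph_dist_eqI[where x = x and y = y and E = M_edges and n = 2] by auto
  qed
  show "M_dist x x = 0" by (rule 0)
  show "M_dist Origin (Mid i) = 1" "M_dist (Mid i) Origin = 1"
    "M_dist (Mid i) Apex = 1" "M_dist Apex (Mid i) = 1"
    by (rule 1; auto simp: M_adjacency)+
  show "M_dist Origin Apex = 2" "M_dist Apex Origin = 2"
    by (rule 2[of _ "Mid 0"]; auto simp: M_adjacency)+
  show "M_dist (Mid i) (Mid j) = 2" if "i \<noteq> j"
    by (rule 2[of _ Origin]; use that in \<open>auto simp: M_adjacency\<close>)
qed

lemma Metric_space_M: "Metric_space UNIV M_dist"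
proof
  have Mid: "M_dist (Mid i) (Mid j) = (if i = j then 0 else 2)" for i j
    by (simp add: M_dist_simps)
  show "0 \<le> M_dist x y" for x y
    by (simp add: M_dist_def graph_dist_def)
  show "M_dist x y = M_dist y x" for x y
    by (cases x; cases y) (auto simp: M_dist_simps(1-7) Mid)
  show "M_dist x y = 0 \<longleftrightarrow> x = y" for x y
    by (cases x; cases y) (auto simp: M_dist_simps(1-7) Mid)
  show "M_dist x z \<le> M_dist x y + M_dist y z" for x y z
    by (cases x; cases y; cases z) (auto simp: M_dist_simps(1-7) Mid)
qed


section \<open>The real sequence space \<open>\<ell>\<^sub>p\<close>\<close>

definition lp_space :: "real \<Rightarrow> (nat \<Rightarrow> real) set" where
  "lp_space p = {a. summable (\<lambda>n. \<bar>a n\<bar> powr p)}"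

definition lp_norm :: "real \<Rightarrow> (nat \<Rightarrow> real) \<Rightarrow> real" where
  "lp_norm p a = (\<Sum>n. \<bar>a n\<bar> powr p) powr (1 / p)"

definition lp_dist :: "real \<Rightarrow> (nat \<Rightarrow> real) \<Rightarrow> (nat \<Rightarrow> real) \<Rightarrow> real" where
  "lp_dist p a b = lp_norm p (\<lambda>n. a n - b n)"


section \<open>Embeddings and the long trapezoid property\<close>

text \<open>
  The condition \<open>1 \<le> D\<close>, implicit in the word distortion, follows from the inequalities for
  \<open>D > 0\<close> as soon as \<open>M\<close> has two points. It has to be stated because the lower bound is void for
  \<open>D \<le> 0\<close> (with \<open>s / 0 = 0\<close>).
\<close>

definition embeds_into_lp :: "'a set \<Rightarrow> ('a \<Rightarrow> 'a \<Rightarrow> real) \<Rightarrow> real \<Rightarrow> real \<Rightarrow> bool" where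
  "embeds_into_lp M d p D \<longleftrightarrow> 1 \<le> D \<and>
     (\<exists>\<phi> s. \<phi> ` M \<subseteq> lp_space p \<and> 0 < s \<and>
        (\<forall>x\<in>M. \<forall>y\<in>M. s / D * d x y \<le> lp_dist p (\<phi> x) (\<phi> y) \<and>
                       lp_dist p (\<phi> x) (\<phi> y) \<le> s * d x y))"

definition long_trapezoid_property :: "'a set \<Rightarrow> ('a \<Rightarrow> 'a \<Rightarrow> real) \<Rightarrow> bool" where
  "long_trapezoid_property M d \<longleftrightarrow>
     (\<forall>N \<epsilon>. finite N \<and> N \<subseteq> M \<and> 0 < \<epsilon> \<longrightarrow>
        (\<exists>u\<in>M. \<exists>v\<in>M. u \<noteq> v \<and>
           (\<forall>x\<in>N. \<forall>y\<in>N. (1 - \<epsilon>) * (d x y + d u v) \<le> d x u + d y v)))"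

end

theory Submission
  imports Defs
begin

text \<open>
  Send \<open>0\<close> and \<open>z\<close> to \<open>-e\<^sub>0\<close> and \<open>e\<^sub>0\<close>, and \<open>x\<^sub>i\<close> to \<open>b e\<^sub>i\<^sub>+\<^sub>1\<close> with \<open>b\<^sup>p = 2\<^sup>p\<^sup>-\<^sup>1\<close>. Then all distances equal
  to \<open>2\<close> are preserved, while each edge gets length \<open>D\<close> with \<open>D\<^sup>p = 1 + 2\<^sup>p\<^sup>-\<^sup>1 < 2\<^sup>p\<close>.
  For the second part, \<open>N = {0, z}\<close> violates the LTP of \<open>M\<close> by a factor of at least \<open>2\<close> for
  every pair \<open>u \<noteq> v\<close>, and an embedding of distortion less than \<open>2\<close> cannot repair this.
\<close>

lemma finite_support_in_lp_space:
  assumes "finite S" "\<And>n. n \<notin> S \<Longrightarrow> a n = 0"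
  shows "a \<in> lp_space p"
  unfolding lp_space_def using assms by (auto intro: summable_finite)

lemma lp_norm_finite_support:
  assumes "finite S" "\<And>n. n \<notin> S \<Longrightarrow> a n = 0"
  shows "lp_norm p a = (\<Sum>n\<in>S. \<bar>a n\<bar> powr p) powr (1 / p)"
  unfolding lp_norm_def using assms by (subst suminf_finite[of S]) auto

lemma lp_dist_commute: "lp_dist p a b = lp_dist p b a"
  by (simp add: lp_dist_def lp_norm_def abs_minus_commute)

text \<open>The image of \<open>M\<close> serves as \<open>A\<close>, tested on the image of
  \<open>N\<close>. The embedding shrinks the gap factor 2 in \<open>far\<close> by at most
  \<open>D\<close>, so a factor of at least 2 / \<open>D\<close> > 1 remains.\<close>

lemma embeds_imp_not_long_trapezoid:
  assumes emb: "embeds_into_lp M d p D" and D: "D < 2"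
    and M: "Metric_space M d" and N: "finite N" "N \<subseteq> M"
    and far: "\<And>u v. u \<in> M \<Longrightarrow> v \<in> M \<Longrightarrow> u \<noteq> v \<Longrightarrow>
                \<exists>x\<in>N. \<exists>y\<in>N. 2 * (d x u + d y v) \<le> d x y + d u v"
  shows "\<exists>A\<subseteq>lp_space p. \<not> long_trapezoid_property A (lp_dist p)"
proof -
  obtain \<phi> s where "1 \<le> D" and sub: "\<phi> ` M \<subseteq> lp_space p" and s: "0 < s"
    and lo: "\<And>x y. x \<in> M \<Longrightarrow> y \<in> M \<Longrightarrow> s / D * d x y \<le> lp_dist p (\<phi> x) (\<phi> y)"
    and up: "\<And>x y. x \<in> M \<Longrightarrow> y \<in> M \<Longrightarrow> lp_dist p (\<phi> x) (\<phi> y) \<le> s * d x y"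
    using emb unfolding embeds_into_lp_def by blast
  \<comment> \<open>Half of 1 - \<open>D\<close> / 2, so that 1 - \<epsilon> stays strictly above
    \<open>D\<close> / 2.\<close>
  define \<epsilon> where "\<epsilon> = (2 - D) / 4"
  have \<epsilon>: "0 < \<epsilon>" "D / 2 < 1 - \<epsilon>"
    using D by (auto simp: \<epsilon>_def field_simps)
  have "\<not> long_trapezoid_property (\<phi> ` M) (lp_dist p)"
  proof
    assume "long_trapezoid_property (\<phi> ` M) (lp_dist p)"
    then have "\<exists>a\<in>\<phi> ` M. \<exists>b\<in>\<phi> ` M. a \<noteq> b \<and> (\<forall>x\<in>\<phi> ` N. \<forall>y\<in>\<phi> ` N.
        (1 - \<epsilon>) * (lp_dist p x y + lp_dist p a b) \<le> lp_dist p x a + lp_dist p y b)"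
      unfolding long_trapezoid_property_def
      by (elim allE[of _ "\<phi> ` N"] allE[of _ \<epsilon>]) (use N \<epsilon>(1) in auto)
    then obtain u v where uv: "u \<in> M" "v \<in> M" "\<phi> u \<noteq> \<phi> v"
      and ltp: "\<And>x y. x \<in> N \<Longrightarrow> y \<in> N \<Longrightarrow>
        (1 - \<epsilon>) * (lp_dist p (\<phi> x) (\<phi> y) + lp_dist p (\<phi> u) (\<phi> v))
          \<le> lp_dist p (\<phi> x) (\<phi> u) + lp_dist p (\<phi> y) (\<phi> v)"
      by (elim bexE imageE conjE) simp
    from uv have "u \<noteq> v" by auto
    with far uv obtain x y where xy: "x \<in> N" "y \<in> N" "2 * (d x u + d y v) \<le> d x y + d u v"
      by blast
    then have "x \<in> M" "y \<in> M" using N by auto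
    have pos: "0 < d x y + d u v"
      using Metric_space.nonneg[OF M, of x y] Metric_space.mdist_pos_eq[OF M uv(1,2)] \<open>u \<noteq> v\<close>
      by linarith
    \<comment> \<open>The chain returns to its first term. It is strict because \<open>D\<close> / 2
      < 1 - \<epsilon> is multiplied by a quantity that \<open>pos\<close> makes positive.\<close>
    have "s * (d x u + d y v) \<le> s * ((d x y + d u v) / 2)"
      using xy(3) s by (intro mult_left_mono) auto
    also have "\<dots> = D / 2 * (s / D * (d x y + d u v))"
      using \<open>1 \<le> D\<close> by simp
    also have "\<dots> < (1 - \<epsilon>) * (s / D * (d x y + d u v))"
      using \<epsilon>(2) s \<open>1 \<le> D\<close> pos by (intro mult_strict_right_mono mult_pos_pos) auto
    also have "\<dots> \<le> (1 - \<epsilon>) * (lp_dist p (\<phi> x) (\<phi> y) + lp_dist p (\<phi> u) (\<phi> v))"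
      using lo[OF \<open>x \<in> M\<close> \<open>y \<in> M\<close>] lo[OF uv(1,2)] \<epsilon>(2) \<open>1 \<le> D\<close>
      by (intro mult_left_mono) (auto simp: distrib_left)
    also have "\<dots> \<le> lp_dist p (\<phi> x) (\<phi> u) + lp_dist p (\<phi> y) (\<phi> v)"
      by (rule ltp[OF xy(1,2)])
    also have "\<dots> \<le> s * (d x u + d y v)"
      using up[OF \<open>x \<in> M\<close> uv(1)] up[OF \<open>y \<in> M\<close> uv(2)] by (simp add: distrib_left)
    finally show False by simp
  qed
  with sub show ?thesis by blast
qed

text \<open>Coordinate 0 is reserved for \<open>Origin\<close> and \<open>Apex\<close>, hence the
  shift to \<open>Suc i\<close>.\<close>

fun M_embedding :: "real \<Rightarrow> point \<Rightarrow> nat \<Rightarrow> real" where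
  "M_embedding p Origin = (\<lambda>n. if n = 0 then -1 else 0)"
| "M_embedding p Apex = (\<lambda>n. if n = 0 then 1 else 0)"
| "M_embedding p (Mid i) = (\<lambda>n. if n = Suc i then 2 powr (1 - 1 / p) else 0)"

lemma M_embedding_in_lp: "M_embedding p x \<in> lp_space p"
  by (rule finite_support_in_lp_space[of "case x of Mid i \<Rightarrow> {Suc i} | _ \<Rightarrow> {0}"];
      cases x; simp)

text \<open>Images with disjoint supports have p-th powers that add: an edge gives 1 + 2^(p-1), two
  distinct middle points give 2 * 2^(p-1) = 2^p.\<close>

lemma lp_dist_M_embedding:
  fixes p :: real
  assumes "1 < p"
  defines "D \<equiv> (1 + 2 powr (p - 1)) powr (1 / p)"
  shows "lp_dist p (M_embedding p x) (M_embedding p y) = (if M_dist x y = 1 then D else M_dist x y)"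
proof -
  let ?d = "\<lambda>x y. lp_dist p (M_embedding p x) (M_embedding p y)"
  have b: "(2 powr (1 - 1 / p)) powr p = 2 powr (p - 1)"
    using assms by (simp add: powr_powr left_diff_distrib)
  have two: "(2 powr p) powr (1 / p) = (2::real)"
    using assms by (simp add: powr_powr)
  have self: "?d x x = 0" for x
    by (simp add: lp_dist_def lp_norm_def)
  have OA: "?d Origin Apex = 2"
    unfolding lp_dist_def by (subst lp_norm_finite_support[of "{0}"]) (auto simp: two)
  have OM: "?d Origin (Mid i) = D" for i
    unfolding lp_dist_def
    by (subst lp_norm_finite_support[of "{0, Suc i}"]) (auto simp: b D_def)
  have AM: "?d Apex (Mid i) = D" for i
    unfolding lp_dist_def
    by (subst lp_norm_finite_support[of "{0, Suc i}"]) (auto simp: b D_def)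
  have MM: "?d (Mid i) (Mid j) = 2" if "i \<noteq> j" for i j
  proof -
    have "2 powr (p - 1) + 2 powr (p - 1) = (2::real) powr p"
      by (simp add: powr_diff)
    then show ?thesis
      unfolding lp_dist_def
      using that by (subst lp_norm_finite_support[of "{Suc i, Suc j}"]) (auto simp: b two)
  qed
  note rev = trans[OF lp_dist_commute OA] trans[OF lp_dist_commute OM] trans[OF lp_dist_commute AM]
  show ?thesis
  proof (cases "x = y")
    case True
    then show ?thesis using self by (simp add: M_dist_simps)
  next
    case False
    then show ?thesis
      by (cases x; cases y)
        (auto simp: M_dist_simps OA OM AM MM rev simp del: M_embedding.simps)
  qed
qed

lemma M_embeds_into_lp:
  fixes p :: real
  assumes "1 < p"
  shows "\<exists>D<2. embeds_into_lp UNIV M_dist p D"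
proof -
  define D where "D = (1 + 2 powr (p - 1)) powr (1 / p)"
  have "1 \<le> D"
    using assms by (auto simp: D_def intro: ge_one_powr_ge_zero)
  \<comment> \<open>Here p > 1 enters: 1 is strictly less than 2^(p-1), which is half of 2^p. At p =
    1 the value of \<open>D\<close> would be exactly 2.\<close>
  have "1 < (2::real) powr (p - 1)"
    using assms by simp
  then have "1 + 2 powr (p - 1) < (2::real) powr p"
    by (simp add: powr_diff)
  then have "D < (2 powr p) powr (1 / p)"
    unfolding D_def using assms by (intro powr_less_mono2) auto
  also have "\<dots> = 2"
    using assms by (simp add: powr_powr)
  finally have "D < 2" .
  \<comment> \<open>With scale s = \<open>D\<close> the lower bound is \<open>M_dist\<close> itself,
    attained at distance 2; the upper bound is attained on edges.\<close>
  have "M_dist x y \<le> lp_dist p (M_embedding p x) (M_embedding p y)"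
    and "lp_dist p (M_embedding p x) (M_embedding p y) \<le> D * M_dist x y" for x y
    using \<open>1 \<le> D\<close> Metric_space.nonneg[OF Metric_space_M, of x y]
    by (auto simp: lp_dist_M_embedding[OF assms] D_def[symmetric] mult_le_cancel_right1)
  then have "embeds_into_lp UNIV M_dist p D"
    unfolding embeds_into_lp_def using \<open>1 \<le> D\<close>
    by (intro conjI exI[of _ "M_embedding p"] exI[of _ D]) (auto simp: M_embedding_in_lp)
  with \<open>D < 2\<close> show ?thesis by blast
qed

text \<open>Take x and y to be the two different points of the pair, matching u or v with itself
  when it is \<open>Origin\<close> or \<open>Apex\<close>. For two middle points both sides equal 4;
  otherwise the inequality reads 2 \<le> 3 or 0 \<le> 4.\<close>

lemma M_far_from_Origin_Apex:
  assumes "u \<noteq> v"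
  shows "\<exists>x\<in>{Origin, Apex}. \<exists>y\<in>{Origin, Apex}.
           2 * (M_dist x u + M_dist y v) \<le> M_dist x y + M_dist u v"
  using assms by (cases u; cases v) (auto simp: M_dist_simps)

theorem proposition4p5:
  fixes p :: real
  assumes "1 < p"
  shows "(\<exists>D<2. embeds_into_lp UNIV M_dist p D) \<and>
         (\<exists>A\<subseteq>lp_space p. \<not> long_trapezoid_property A (lp_dist p))"
proof -
  obtain D where D: "D < 2" "embeds_into_lp UNIV M_dist p D"
    using M_embeds_into_lp[OF assms] by blast
  have "\<exists>A\<subseteq>lp_space p. \<not> long_trapezoid_property A (lp_dist p)"
    by (rule embeds_imp_not_long_trapezoid[OF D(2,1) Metric_space_M, of "{Origin, Apex}"])
      (use M_far_from_Origin_Apex in auto)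
  with D show ?thesis by blast
qed

end
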